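(* Let $k$ be a field, $A$ an associative unital $k$-algebra, $I$ and $E$ left and right $A$-modules, $C\in \operatorname{Hom}_k(A\otimes_k A,I)$ an element satisfying the cocycle condition $xC(y,z)-C(xy,z)+C(x,yz)-C(x,y)z=0$ for all $x,y,z\in A$, and let $B^C=I\oplus^C A$. Let $d\in \operatorname{Der}_k(A,I)$ be a derivation. Let $\mathcal{J}^1_I(E)=I\otimes_A E\oplus E$ and define $$(u,x)(w\otimes e,f)=(u\otimes f+xw\otimes e+d(x)\otimes f,\; xf)$$ for $(u,x)\in B^C$ and $(w\otimes e,f)\in \mathcal{J}^1_I(E)$. Then, with this action, the abelian group $\mathcal{J}^1_I(E)$ is a left $B^C$-module if and only if $C(y,x)\otimes f=0$ in $I\otimes_A E$ for all $y,x\in A$ and $f\in E$.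
   Context: A left and right $A$-module means an $A$-$A$-bimodule on which $k$ acts centrally. $I\oplus^C A$ is the associative unital $k$-algebra with underlying abelian group $I\oplus A$ and product $(u,x)(v,y)=(uy+xv+C(x,y),\,xy)$, where $C(x,y)=C(x\otimes y)$. $\operatorname{Der}_k(A,I)$ is the set of $k$-linear maps $d:A\to I$ with $d(xy)=xd(y)+d(x)y$ for all $x,y\in A$. The displayed action is extended additively in the first component of $\mathcal{J}^1_I(E)$, i.e. $(u,x)(\omega,f)=(u\otimes f+x\omega+d(x)\otimes f,\,xf)$ for $\omega\in I\otimes_A E$. $\mathcal{J}^1_I(E)$ is called the first order $I$-jet bundle of $E$. *)

theory Defs
  imports "HOL-Algebra.Module" "HOL-Algebra.Generated_Groups" "HOL-Algebra.Free_Abelian_Groups"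
begin

text \<open>The library locale \<open>module\<close> requires a commutative ring of scalars, so modules over
  an arbitrary associative unital ring are set up here. All modules are unital. As in the library,
  the multiplicative fields \<open>mult\<close> and \<open>one\<close> of a module record carry no meaning.\<close>

locale left_module = R?: ring R + M?: abelian_group M for R (structure) and M (structure) +
  assumes lsmult_closed:
      "\<lbrakk>a \<in> carrier R; x \<in> carrier M\<rbrakk> \<Longrightarrow> a \<odot>\<^bsub>M\<^esub> x \<in> carrier M"
    and lsmult_l_distr:
      "\<lbrakk>a \<in> carrier R; b \<in> carrier R; x \<in> carrier M\<rbrakk> \<Longrightarrow>
       (a \<oplus> b) \<odot>\<^bsub>M\<^esub> x = a \<odot>\<^bsub>M\<^esub> x \<oplus>\<^bsub>M\<^esub> b \<odot>\<^bsub>M\<^esub> x"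
    and lsmult_r_distr:
      "\<lbrakk>a \<in> carrier R; x \<in> carrier M; y \<in> carrier M\<rbrakk> \<Longrightarrow>
       a \<odot>\<^bsub>M\<^esub> (x \<oplus>\<^bsub>M\<^esub> y) = a \<odot>\<^bsub>M\<^esub> x \<oplus>\<^bsub>M\<^esub> a \<odot>\<^bsub>M\<^esub> y"
    and lsmult_assoc:
      "\<lbrakk>a \<in> carrier R; b \<in> carrier R; x \<in> carrier M\<rbrakk> \<Longrightarrow>
       (a \<otimes> b) \<odot>\<^bsub>M\<^esub> x = a \<odot>\<^bsub>M\<^esub> (b \<odot>\<^bsub>M\<^esub> x)"
    and lsmult_one:
      "x \<in> carrier M \<Longrightarrow> \<one> \<odot>\<^bsub>M\<^esub> x = x"

record ('s, 'r, 'm) bimod = "('s, 'm) module" +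
  rsmult :: "'m \<Rightarrow> 'r \<Rightarrow> 'm" (infixl \<open>\<cdot>\<index>\<close> 70)

locale bimodule = left_module S M + R: ring R
  for S (structure) and R (structure) and M (structure) +
  assumes rsmult_closed:
      "\<lbrakk>x \<in> carrier M; a \<in> carrier R\<rbrakk> \<Longrightarrow> x \<cdot>\<^bsub>M\<^esub> a \<in> carrier M"
    and rsmult_r_distr:
      "\<lbrakk>x \<in> carrier M; a \<in> carrier R; b \<in> carrier R\<rbrakk> \<Longrightarrow>
       x \<cdot>\<^bsub>M\<^esub> (a \<oplus>\<^bsub>R\<^esub> b) = x \<cdot>\<^bsub>M\<^esub> a \<oplus>\<^bsub>M\<^esub> x \<cdot>\<^bsub>M\<^esub> b"
    and rsmult_l_distr:
      "\<lbrakk>x \<in> carrier M; y \<in> carrier M; a \<in> carrier R\<rbrakk> \<Longrightarrow>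
       (x \<oplus>\<^bsub>M\<^esub> y) \<cdot>\<^bsub>M\<^esub> a = x \<cdot>\<^bsub>M\<^esub> a \<oplus>\<^bsub>M\<^esub> y \<cdot>\<^bsub>M\<^esub> a"
    and rsmult_assoc:
      "\<lbrakk>x \<in> carrier M; a \<in> carrier R; b \<in> carrier R\<rbrakk> \<Longrightarrow>
       x \<cdot>\<^bsub>M\<^esub> (a \<otimes>\<^bsub>R\<^esub> b) = (x \<cdot>\<^bsub>M\<^esub> a) \<cdot>\<^bsub>M\<^esub> b"
    and rsmult_one:
      "x \<in> carrier M \<Longrightarrow> x \<cdot>\<^bsub>M\<^esub> \<one>\<^bsub>R\<^esub> = x"
    and smult_rsmult_assoc:
      "\<lbrakk>s \<in> carrier S; x \<in> carrier M; a \<in> carrier R\<rbrakk> \<Longrightarrow>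
       (s \<odot>\<^bsub>M\<^esub> x) \<cdot>\<^bsub>M\<^esub> a = s \<odot>\<^bsub>M\<^esub> (x \<cdot>\<^bsub>M\<^esub> a)"

text \<open>Associative unital algebras; the library locale \<open>algebra\<close> is restricted to commutative ones.\<close>

locale assoc_algebra = module K A + A?: ring A for K (structure) and A (structure) +
  assumes smult_mult_left:
      "\<lbrakk>c \<in> carrier K; x \<in> carrier A; y \<in> carrier A\<rbrakk> \<Longrightarrow>
       (c \<odot>\<^bsub>A\<^esub> x) \<otimes>\<^bsub>A\<^esub> y = c \<odot>\<^bsub>A\<^esub> (x \<otimes>\<^bsub>A\<^esub> y)"
    and smult_mult_right:
      "\<lbrakk>c \<in> carrier K; x \<in> carrier A; y \<in> carrier A\<rbrakk> \<Longrightarrow>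
       x \<otimes>\<^bsub>A\<^esub> (c \<odot>\<^bsub>A\<^esub> y) = c \<odot>\<^bsub>A\<^esub> (x \<otimes>\<^bsub>A\<^esub> y)"

text \<open>Left and right \<open>A\<close>-modules: the scalars \<open>K\<close> act through \<open>K \<rightarrow> A\<close>,
  and the two resulting actions agree.\<close>

locale left_right_module = assoc_algebra K A + bimodule A A M
  for K (structure) and A (structure) and M (structure) +
  assumes central:
      "\<lbrakk>c \<in> carrier K; x \<in> carrier M\<rbrakk> \<Longrightarrow>
       (c \<odot>\<^bsub>A\<^esub> \<one>\<^bsub>A\<^esub>) \<odot>\<^bsub>M\<^esub> x = x \<cdot>\<^bsub>M\<^esub> (c \<odot>\<^bsub>A\<^esub> \<one>\<^bsub>A\<^esub>)"

definition restrict_scalars ::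
    "('k, 'a, 'x) module_scheme \<Rightarrow> ('a, 'm, 'y) module_scheme \<Rightarrow> ('k, 'm) module" where
  "restrict_scalars A M =
     \<lparr>carrier = carrier M, mult = mult M, one = one M, ring.zero = ring.zero M, ring.add = ring.add M,
      smult = (\<lambda>c m. (c \<odot>\<^bsub>A\<^esub> \<one>\<^bsub>A\<^esub>) \<odot>\<^bsub>M\<^esub> m)\<rparr>"

text \<open>A module over a commutative ring, with its scalars also acting on the right.\<close>

definition symmetric_bimod :: "('k, 'm, 'x) module_scheme \<Rightarrow> ('k, 'k, 'm) bimod" where
  "symmetric_bimod M =
     \<lparr>carrier = carrier M, mult = mult M, one = one M, ring.zero = ring.zero M, ring.add = ring.add M,
      smult = smult M, rsmult = (\<lambda>m c. c \<odot>\<^bsub>M\<^esub> m)\<rparr>"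

definition linear_maps ::
    "('k, 'z) ring_scheme \<Rightarrow> ('k, 'm, 'x) module_scheme \<Rightarrow> ('k, 'n, 'y) module_scheme \<Rightarrow>
     ('m \<Rightarrow> 'n) set" where
  "linear_maps K M N =
     {h \<in> carrier M \<rightarrow> carrier N.
        (\<forall>x \<in> carrier M. \<forall>y \<in> carrier M. h (x \<oplus>\<^bsub>M\<^esub> y) = h x \<oplus>\<^bsub>N\<^esub> h y) \<and>
        (\<forall>c \<in> carrier K. \<forall>x \<in> carrier M. h (c \<odot>\<^bsub>M\<^esub> x) = c \<odot>\<^bsub>N\<^esub> h x)}"

text \<open>The tensor product of a bimodule \<open>M\<close>, with right scalars \<open>R\<close>, and a left
  \<open>R\<close>-module \<open>N\<close>: the free abelian group on pairs modulo the subgroup \<open>tensor_rel R M N\<close>.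
  Group operations on \<open>free_Abelian_group\<close> are written multiplicatively in the library.\<close>

definition tensor_gens ::
    "('r, 'z) ring_scheme \<Rightarrow> ('s, 'r, 'm, 'x) bimod_scheme \<Rightarrow> ('r, 'n, 'y) module_scheme \<Rightarrow>
     ('m \<times> 'n \<Rightarrow>\<^sub>0 int) set" where
  "tensor_gens R M N =
     {frag_of (m \<oplus>\<^bsub>M\<^esub> m', n) - frag_of (m, n) - frag_of (m', n) | m m' n.
        m \<in> carrier M \<and> m' \<in> carrier M \<and> n \<in> carrier N} \<union>
     {frag_of (m, n \<oplus>\<^bsub>N\<^esub> n') - frag_of (m, n) - frag_of (m, n') | m n n'.
        m \<in> carrier M \<and> n \<in> carrier N \<and> n' \<in> carrier N} \<union>
     {frag_of (m \<cdot>\<^bsub>M\<^esub> r, n) - frag_of (m, r \<odot>\<^bsub>N\<^esub> n) | m r n.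
        m \<in> carrier M \<and> r \<in> carrier R \<and> n \<in> carrier N}"

definition tensor_rel ::
    "('r, 'z) ring_scheme \<Rightarrow> ('s, 'r, 'm, 'x) bimod_scheme \<Rightarrow> ('r, 'n, 'y) module_scheme \<Rightarrow>
     ('m \<times> 'n \<Rightarrow>\<^sub>0 int) set" where
  "tensor_rel R M N =
     generate (free_Abelian_group (carrier M \<times> carrier N)) (tensor_gens R M N)"

definition tensor_coset ::
    "('r, 'z) ring_scheme \<Rightarrow> ('s, 'r, 'm, 'x) bimod_scheme \<Rightarrow> ('r, 'n, 'y) module_scheme \<Rightarrow>
     ('m \<times> 'n \<Rightarrow>\<^sub>0 int) \<Rightarrow> ('m \<times> 'n \<Rightarrow>\<^sub>0 int) set" where
  "tensor_coset R M N t =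
     tensor_rel R M N #>\<^bsub>free_Abelian_group (carrier M \<times> carrier N)\<^esub> t"

text \<open>The left action is induced by \<open>s (m \<otimes> n) = s m \<otimes> n\<close>. All representatives of a coset
  \<open>T\<close> have their images in the same coset, so the union below is that single coset.\<close>

definition tensor ::
    "('r, 'z) ring_scheme \<Rightarrow> ('s, 'r, 'm, 'x) bimod_scheme \<Rightarrow> ('r, 'n, 'y) module_scheme \<Rightarrow>
     ('s, ('m \<times> 'n \<Rightarrow>\<^sub>0 int) set) module" where
  "tensor R M N =
     (let Q = free_Abelian_group (carrier M \<times> carrier N) Mod tensor_rel R M N in
      \<lparr>carrier = carrier Q, mult = undefined, one = undefined, ring.zero = one Q, ring.add = mult Q,
       smult = (\<lambda>s T. \<Union>t \<in> T. tensor_coset R M N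
                       (frag_extend (\<lambda>(m, n). frag_of (s \<odot>\<^bsub>M\<^esub> m, n)) t))\<rparr>)"

definition tensor_elt ::
    "('r, 'z) ring_scheme \<Rightarrow> ('s, 'r, 'm, 'x) bimod_scheme \<Rightarrow> ('r, 'n, 'y) module_scheme \<Rightarrow>
     'm \<Rightarrow> 'n \<Rightarrow> ('m \<times> 'n \<Rightarrow>\<^sub>0 int) set" where
  "tensor_elt R M N m n = tensor_coset R M N (frag_of (m, n))"

text \<open>\<open>Hom\<^sub>k(A \<otimes>\<^sub>k A, I)\<close>, and the notation \<open>C(x, y) = C(x \<otimes> y)\<close>.\<close>

definition cochains ::
    "('k, 'z) ring_scheme \<Rightarrow> ('k, 'a, 'x) module_scheme \<Rightarrow> ('a, 'a, 'i, 'y) bimod_scheme \<Rightarrow>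
     (('a \<times> 'a \<Rightarrow>\<^sub>0 int) set \<Rightarrow> 'i) set" where
  "cochains K A I =
     linear_maps K (tensor K (symmetric_bimod A) A) (restrict_scalars A I)"

definition cochain_app ::
    "('k, 'z) ring_scheme \<Rightarrow> ('k, 'a, 'x) module_scheme \<Rightarrow>
     (('a \<times> 'a \<Rightarrow>\<^sub>0 int) set \<Rightarrow> 'i) \<Rightarrow> 'a \<Rightarrow> 'a \<Rightarrow> 'i" where
  "cochain_app K A C x y = C (tensor_elt K (symmetric_bimod A) A x y)"

definition cocycle_condition ::
    "('k, 'z) ring_scheme \<Rightarrow> ('k, 'a, 'x) module_scheme \<Rightarrow> ('a, 'a, 'i, 'y) bimod_scheme \<Rightarrow>
     (('a \<times> 'a \<Rightarrow>\<^sub>0 int) set \<Rightarrow> 'i) \<Rightarrow> bool" where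
  "cocycle_condition K A I C \<longleftrightarrow>
     (\<forall>x \<in> carrier A. \<forall>y \<in> carrier A. \<forall>z \<in> carrier A.
        x \<odot>\<^bsub>I\<^esub> cochain_app K A C y z \<ominus>\<^bsub>I\<^esub> cochain_app K A C (x \<otimes>\<^bsub>A\<^esub> y) z
        \<oplus>\<^bsub>I\<^esub> cochain_app K A C x (y \<otimes>\<^bsub>A\<^esub> z) \<ominus>\<^bsub>I\<^esub> cochain_app K A C x y \<cdot>\<^bsub>I\<^esub> z = \<zero>\<^bsub>I\<^esub>)"

definition Der ::
    "('k, 'z) ring_scheme \<Rightarrow> ('k, 'a, 'x) module_scheme \<Rightarrow> ('a, 'a, 'i, 'y) bimod_scheme \<Rightarrow>
     ('a \<Rightarrow> 'i) set" where
  "Der K A I =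
     {d \<in> linear_maps K A (restrict_scalars A I).
        \<forall>x \<in> carrier A. \<forall>y \<in> carrier A. d (x \<otimes>\<^bsub>A\<^esub> y) = x \<odot>\<^bsub>I\<^esub> d y \<oplus>\<^bsub>I\<^esub> d x \<cdot>\<^bsub>I\<^esub> y}"

text \<open>The algebra \<open>I \<oplus>\<^sup>C A\<close>. A cocycle need not be normalised, so the unit is
  \<open>(- C(1, 1), 1)\<close>: the cocycle condition gives \<open>C(1, z) = C(1, 1) z\<close> and
  \<open>C(x, 1) = x C(1, 1)\<close>.\<close>

definition ext_algebra ::
    "('k, 'z) ring_scheme \<Rightarrow> ('k, 'a, 'x) module_scheme \<Rightarrow> ('a, 'a, 'i, 'y) bimod_scheme \<Rightarrow>
     (('a \<times> 'a \<Rightarrow>\<^sub>0 int) set \<Rightarrow> 'i) \<Rightarrow> ('k, 'i \<times> 'a) module" where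
  "ext_algebra K A I C =
     \<lparr>carrier = carrier I \<times> carrier A,
      mult = (\<lambda>(u, x) (v, y).
                (u \<cdot>\<^bsub>I\<^esub> y \<oplus>\<^bsub>I\<^esub> x \<odot>\<^bsub>I\<^esub> v \<oplus>\<^bsub>I\<^esub> cochain_app K A C x y, x \<otimes>\<^bsub>A\<^esub> y)),
      one = (\<ominus>\<^bsub>I\<^esub> cochain_app K A C \<one>\<^bsub>A\<^esub> \<one>\<^bsub>A\<^esub>, \<one>\<^bsub>A\<^esub>),
      ring.zero = (\<zero>\<^bsub>I\<^esub>, \<zero>\<^bsub>A\<^esub>),
      ring.add = (\<lambda>(u, x) (v, y). (u \<oplus>\<^bsub>I\<^esub> v, x \<oplus>\<^bsub>A\<^esub> y)),
      smult = (\<lambda>c (u, x). (c \<odot>\<^bsub>restrict_scalars A I\<^esub> u, c \<odot>\<^bsub>A\<^esub> x))\<rparr>"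

text \<open>The first order \<open>I\<close>-jet bundle \<open>I \<otimes>\<^sub>A E \<oplus> E\<close>, with the action of
  \<open>I \<oplus>\<^sup>C A\<close> (which does not involve \<open>C\<close>).\<close>

definition jet_bundle ::
    "('k, 'a, 'x) module_scheme \<Rightarrow> ('a, 'a, 'i, 'y) bimod_scheme \<Rightarrow>
     ('a, 'a, 'e, 'z) bimod_scheme \<Rightarrow> ('a \<Rightarrow> 'i) \<Rightarrow>
     ('i \<times> 'a, ('i \<times> 'e \<Rightarrow>\<^sub>0 int) set \<times> 'e) module" where
  "jet_bundle A I E d =
     (let T = tensor A I E in
      \<lparr>carrier = carrier T \<times> carrier E, mult = undefined, one = undefined,
       ring.zero = (\<zero>\<^bsub>T\<^esub>, \<zero>\<^bsub>E\<^esub>),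
       ring.add = (\<lambda>(\<omega>, f) (\<omega>', f'). (\<omega> \<oplus>\<^bsub>T\<^esub> \<omega>', f \<oplus>\<^bsub>E\<^esub> f')),
       smult = (\<lambda>(u, x) (\<omega>, f).
                  (tensor_elt A I E u f \<oplus>\<^bsub>T\<^esub> x \<odot>\<^bsub>T\<^esub> \<omega> \<oplus>\<^bsub>T\<^esub> tensor_elt A I E (d x) f,
                   x \<odot>\<^bsub>E\<^esub> f))\<rparr>)"

end

theory Submission
  imports Defs
begin

text \<open>Since \<open>d\<close> is a derivation and the tensor product is balanced over \<open>A\<close>, the two
  composites \<open>(p q) m\<close> and \<open>p (q m)\<close>, for \<open>p = (v, y)\<close>, \<open>q = (u, x)\<close>
  and \<open>m = (\<omega>, f)\<close>, differ exactly by \<open>C(y, x) \<otimes> f\<close>. As the unit is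
  \<open>(- C(1, 1), 1)\<close>, it moves \<open>(\<omega>, f)\<close> by \<open>- C(1, 1) \<otimes> f\<close>. All other module
  axioms hold for every \<open>C\<close>.\<close>

section \<open>Additive maps between abelian groups\<close>

lemma (in abelian_group) additive_zero:
  assumes "abelian_group H" and "h \<in> carrier G \<rightarrow> carrier H"
    and "\<And>x y. \<lbrakk>x \<in> carrier G; y \<in> carrier G\<rbrakk> \<Longrightarrow> h (x \<oplus> y) = h x \<oplus>\<^bsub>H\<^esub> h y"
  shows "h \<zero> = \<zero>\<^bsub>H\<^esub>"
proof -
  interpret H: abelian_group H by fact
  have "h \<zero> \<in> carrier H" "h \<zero> \<oplus>\<^bsub>H\<^esub> h \<zero> = h \<zero>"
    using assms(2) assms(3)[of \<zero> \<zero>] by auto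
  then show ?thesis by (metis H.add.r_cancel_one)
qed

lemma (in abelian_group) additive_minus:
  assumes "abelian_group H" and "h \<in> carrier G \<rightarrow> carrier H"
    and "\<And>x y. \<lbrakk>x \<in> carrier G; y \<in> carrier G\<rbrakk> \<Longrightarrow> h (x \<oplus> y) = h x \<oplus>\<^bsub>H\<^esub> h y"
    and "x \<in> carrier G"
  shows "h (\<ominus> x) = \<ominus>\<^bsub>H\<^esub> h x"
proof -
  interpret H: abelian_group H by fact
  have "h (\<ominus> x) \<oplus>\<^bsub>H\<^esub> h x = \<zero>\<^bsub>H\<^esub>"
    using assms(3)[of "\<ominus> x" x] additive_zero[OF assms(1-3)] assms(4) by (simp add: l_neg)
  then show ?thesis
    using assms(2,4) by (auto intro!: H.minus_equality[symmetric])
qed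

section \<open>The tensor product\<close>

text \<open>One locale serves two products: \<open>A\<close> with itself over \<open>k\<close>,
  where cochains are defined, and \<open>I \<otimes> E\<close> over \<open>A\<close>. The product is
  balanced over \<open>R\<close>, and \<open>S\<close> acts from the left.\<close>

locale balanced_pair = M: bimodule S R M + N: left_module R N
  for S (structure) and R (structure) and M (structure) and N (structure)
begin

abbreviation "F \<equiv> free_Abelian_group (carrier M \<times> carrier N)"
abbreviation "T \<equiv> tensor R M N"
abbreviation "coset \<equiv> tensor_coset R M N"
abbreviation elt (infixl \<open>\<otimes>\<^sub>T\<close> 70) where "m \<otimes>\<^sub>T n \<equiv> tensor_elt R M N m n"
abbreviation "act s \<equiv> frag_extend (\<lambda>(m, n). frag_of (s \<odot>\<^bsub>M\<^esub> m, n))"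

sublocale F: comm_group F
  by (rule abelian_free_Abelian_group)

section \<open>The quotient group of cosets\<close>

lemma diff_closed: "\<lbrakk>t \<in> carrier F; t' \<in> carrier F\<rbrakk> \<Longrightarrow> t - t' \<in> carrier F"
  using keys_diff[of t t'] by auto

lemma tensor_gens_subset: "tensor_gens R M N \<subseteq> carrier F"
  unfolding tensor_gens_def
  by (auto intro!: diff_closed simp del: carrier_free_Abelian_group_iff
      simp: M.rsmult_closed N.lsmult_closed)

lemma subgroup_tensor_rel: "subgroup (tensor_rel R M N) F"
  unfolding tensor_rel_def by (rule F.generate_is_subgroup[OF tensor_gens_subset])

sublocale rel: normal "tensor_rel R M N" F
  by (simp add: F.subgroup_imp_normal subgroup_tensor_rel)

text \<open>The group operation of \<open>F\<close> is \<open>+\<close> of formal sums, so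
  \<open>t = (t - t') + t'\<close> exhibits the coset witness.\<close>

lemma mem_coset_iff: "t \<in> coset t' \<longleftrightarrow> t - t' \<in> tensor_rel R M N"
  unfolding tensor_coset_def r_coset_def by (auto intro!: bexI[of _ "t - t'"])

lemma coset_eq_iff:
  assumes "t \<in> carrier F" "t' \<in> carrier F"
  shows "coset t = coset t' \<longleftrightarrow> t - t' \<in> tensor_rel R M N"
  unfolding mem_coset_iff[symmetric] tensor_coset_def
  by (metis F.rcos_self F.repr_independence assms subgroup_tensor_rel)

lemma carrier_tensor: "carrier T = coset ` carrier F"
  by (simp add: tensor_def carrier_FactGroup tensor_coset_def)

lemma coset_closed: "t \<in> carrier F \<Longrightarrow> coset t \<in> carrier T"
  by (simp only: carrier_tensor imageI)

lemma coset_add: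
  "\<lbrakk>t \<in> carrier F; t' \<in> carrier F\<rbrakk> \<Longrightarrow> coset t \<oplus>\<^bsub>T\<^esub> coset t' = coset (t + t')"
  using rel.rcos_sum[of t t'] by (simp add: tensor_def tensor_coset_def)

lemma coset_zero: "coset 0 = \<zero>\<^bsub>T\<^esub>"
  using F.coset_mult_one[OF rel.subset] by (simp add: tensor_def tensor_coset_def)

sublocale T: abelian_group T
proof -
  interpret Q: comm_group "F Mod tensor_rel R M N"
    by (rule F.abelian_FactGroup[OF subgroup_tensor_rel])
  show "abelian_group T"
    using Q.m_closed Q.one_closed Q.m_assoc Q.m_comm Q.l_one Q.l_inv_ex
    by (intro abelian_groupI) (auto simp: tensor_def)
qed

text \<open>Prepares for \<open>tensor_induct\<close>: \<open>frag_induction\<close> builds formal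
  sums by differences.\<close>

lemma coset_diff:
  assumes "t \<in> carrier F" "t' \<in> carrier F"
  shows "coset (t - t') = coset t \<ominus>\<^bsub>T\<^esub> coset t'"
proof -
  have "t - t' \<in> carrier F" using assms by (rule diff_closed)
  then have "coset (t - t') \<oplus>\<^bsub>T\<^esub> coset t' = coset t"
    using assms by (simp only: coset_add) simp
  then show ?thesis
    using \<open>t - t' \<in> carrier F\<close> assms coset_closed
    by (metis T.add.inv_solve_right' a_minus_def T.minus_eq)
qed

section \<open>Pure tensors: biadditivity, balancing and generation\<close>

lemma tensor_elt_closed [simp, intro]:
  "\<lbrakk>m \<in> carrier M; n \<in> carrier N\<rbrakk> \<Longrightarrow> m \<otimes>\<^sub>T n \<in> carrier T"
  by (simp add: tensor_elt_def coset_closed)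

text \<open>Each of the three defining identities of pure tensors follows from this by exhibiting a
  single generator.\<close>

lemma coset_eqI:
  "\<lbrakk>t \<in> carrier F; t' \<in> carrier F; t - t' \<in> tensor_gens R M N\<rbrakk> \<Longrightarrow> coset t = coset t'"
  by (simp only: coset_eq_iff) (simp add: tensor_rel_def generate.incl)

lemma tensor_elt_add_left:
  assumes "m \<in> carrier M" "m' \<in> carrier M" "n \<in> carrier N"
  shows "(m \<oplus>\<^bsub>M\<^esub> m') \<otimes>\<^sub>T n = m \<otimes>\<^sub>T n \<oplus>\<^bsub>T\<^esub> m' \<otimes>\<^sub>T n"
proof -
  have "coset (frag_of (m \<oplus>\<^bsub>M\<^esub> m', n)) = coset (frag_of (m, n) + frag_of (m', n))"
  proof (rule coset_eqI)
    \<comment> \<open>The generators subtract their summands one at a time; regrouping brings the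
      difference into that form.\<close>
    have "frag_of (m \<oplus>\<^bsub>M\<^esub> m', n) - (frag_of (m, n) + frag_of (m', n)) =
        frag_of (m \<oplus>\<^bsub>M\<^esub> m', n) - frag_of (m, n) - frag_of (m', n)"
      by (simp add: algebra_simps)
    then show "frag_of (m \<oplus>\<^bsub>M\<^esub> m', n) - (frag_of (m, n) + frag_of (m', n)) \<in> tensor_gens R M N"
      unfolding tensor_gens_def using assms by blast
  qed (use assms F.m_closed in auto)
  then show ?thesis
    using assms by (simp add: tensor_elt_def coset_add)
qed

lemma tensor_elt_add_right:
  assumes "m \<in> carrier M" "n \<in> carrier N" "n' \<in> carrier N"
  shows "m \<otimes>\<^sub>T (n \<oplus>\<^bsub>N\<^esub> n') = m \<otimes>\<^sub>T n \<oplus>\<^bsub>T\<^esub> m \<otimes>\<^sub>T n'"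
proof -
  have "coset (frag_of (m, n \<oplus>\<^bsub>N\<^esub> n')) = coset (frag_of (m, n) + frag_of (m, n'))"
  proof (rule coset_eqI)
    have "frag_of (m, n \<oplus>\<^bsub>N\<^esub> n') - (frag_of (m, n) + frag_of (m, n')) =
        frag_of (m, n \<oplus>\<^bsub>N\<^esub> n') - frag_of (m, n) - frag_of (m, n')"
      by (simp add: algebra_simps)
    then show "frag_of (m, n \<oplus>\<^bsub>N\<^esub> n') - (frag_of (m, n) + frag_of (m, n')) \<in> tensor_gens R M N"
      unfolding tensor_gens_def using assms by blast
  qed (use assms F.m_closed in auto)
  then show ?thesis
    using assms by (simp add: tensor_elt_def coset_add)
qed

lemma tensor_elt_balanced:
  assumes "m \<in> carrier M" "r \<in> carrier R" "n \<in> carrier N"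
  shows "(m \<cdot>\<^bsub>M\<^esub> r) \<otimes>\<^sub>T n = m \<otimes>\<^sub>T (r \<odot>\<^bsub>N\<^esub> n)"
  unfolding tensor_elt_def
proof (rule coset_eqI)
  show "frag_of (m \<cdot>\<^bsub>M\<^esub> r, n) - frag_of (m, r \<odot>\<^bsub>N\<^esub> n) \<in> tensor_gens R M N"
    unfolding tensor_gens_def using assms by blast
qed (use assms in \<open>auto simp: M.rsmult_closed N.lsmult_closed\<close>)

text \<open>Every coset has a representative supported on
  \<open>carrier M \<times> carrier N\<close>, and differences of basis elements reach all such
  formal sums. Hence pure tensors generate \<open>T\<close>.\<close>

lemma tensor_induct [consumes 1, case_names zero elt diff]:
  assumes "\<omega> \<in> carrier T" and "P \<zero>\<^bsub>T\<^esub>"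
    and "\<And>m n. \<lbrakk>m \<in> carrier M; n \<in> carrier N\<rbrakk> \<Longrightarrow> P (m \<otimes>\<^sub>T n)"
    and "\<And>\<omega> \<omega>'. \<lbrakk>\<omega> \<in> carrier T; \<omega>' \<in> carrier T; P \<omega>; P \<omega>'\<rbrakk> \<Longrightarrow> P (\<omega> \<ominus>\<^bsub>T\<^esub> \<omega>')"
  shows "P \<omega>"
proof -
  obtain t where t: "t \<in> carrier F" "\<omega> = coset t"
    using assms(1) by (auto simp: carrier_tensor)
  have "Poly_Mapping.keys t \<subseteq> carrier M \<times> carrier N" using t by simp
  \<comment> \<open>Carrier membership is carried through the induction because
    \<open>coset_diff\<close> asks for it.\<close>
  then have "t \<in> carrier F \<and> P (coset t)"
  proof (induction rule: frag_induction)
    case (diff a b)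
    then show ?case
      using coset_diff[of a b] keys_diff[of a b] assms(4) coset_closed by auto
  qed (use assms(2,3) coset_zero in \<open>auto simp: tensor_elt_def\<close>)
  then show ?thesis using t by simp
qed

text \<open>The uniqueness half of the universal property: the set on which two additive maps agree
  is closed under differences, so it is everything once it contains the pure tensors.\<close>

lemma additive_eqI:
  assumes "\<omega> \<in> carrier T" "abelian_group H"
    and "g \<in> carrier T \<rightarrow> carrier H" "h \<in> carrier T \<rightarrow> carrier H"
    and g: "\<And>x y. \<lbrakk>x \<in> carrier T; y \<in> carrier T\<rbrakk> \<Longrightarrow> g (x \<oplus>\<^bsub>T\<^esub> y) = g x \<oplus>\<^bsub>H\<^esub> g y"
    and h: "\<And>x y. \<lbrakk>x \<in> carrier T; y \<in> carrier T\<rbrakk> \<Longrightarrow> h (x \<oplus>\<^bsub>T\<^esub> y) = h x \<oplus>\<^bsub>H\<^esub> h y"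
    and "\<And>m n. \<lbrakk>m \<in> carrier M; n \<in> carrier N\<rbrakk> \<Longrightarrow> g (m \<otimes>\<^sub>T n) = h (m \<otimes>\<^sub>T n)"
  shows "g \<omega> = h \<omega>"
  using assms(1)
proof (induction rule: tensor_induct)
  case zero
  show ?case using T.additive_zero[of H] assms by metis
next
  case (diff \<omega> \<omega>')
  have "g (\<ominus>\<^bsub>T\<^esub> \<omega>') = \<ominus>\<^bsub>H\<^esub> g \<omega>'" "h (\<ominus>\<^bsub>T\<^esub> \<omega>') = \<ominus>\<^bsub>H\<^esub> h \<omega>'"
    using T.additive_minus[OF assms(2)] assms diff by blast+
  then show ?case using diff g h by (simp add: T.minus_eq)
qed (use assms in simp)

section \<open>The left action on the tensor product\<close>

lemma act_closed:
  assumes "s \<in> carrier S" "t \<in> carrier F"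
  shows "act s t \<in> carrier F"
proof -
  have "Poly_Mapping.keys (case p of (m, n) \<Rightarrow> frag_of (s \<odot>\<^bsub>M\<^esub> m, n)) \<subseteq> carrier M \<times> carrier N"
    if "p \<in> Poly_Mapping.keys t" for p
    using that assms by (auto simp: M.lsmult_closed)
  then show ?thesis
    using keys_frag_extend[of _ t] by (force simp only: carrier_free_Abelian_group_iff)
qed

text \<open>The first family is preserved by distributivity in \<open>M\<close>, the second because
  \<open>s\<close> changes only the first entry, the third by the compatibility
  \<open>(s m) r = s (m r)\<close> of the two actions.\<close>

lemma act_gens:
  assumes "s \<in> carrier S" "t \<in> tensor_gens R M N"
  shows "act s t \<in> tensor_gens R M N"
  using assms(2) unfolding tensor_gens_def
proof (elim UnE, goal_cases)
  case 1
  then obtain m m' n where "m \<in> carrier M" "m' \<in> carrier M" "n \<in> carrier N"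
    "t = frag_of (m \<oplus>\<^bsub>M\<^esub> m', n) - frag_of (m, n) - frag_of (m', n)" by blast
  then show ?case
    using assms(1) by (intro UnI1) (force simp: frag_extend_diff M.lsmult_r_distr M.lsmult_closed)
next
  case 2
  then obtain m n n' where "m \<in> carrier M" "n \<in> carrier N" "n' \<in> carrier N"
    "t = frag_of (m, n \<oplus>\<^bsub>N\<^esub> n') - frag_of (m, n) - frag_of (m, n')" by blast
  then show ?case
    using assms(1) by (intro UnI1 UnI2) (force simp: frag_extend_diff M.lsmult_closed)
next
  case 3
  then obtain m r n where "m \<in> carrier M" "r \<in> carrier R" "n \<in> carrier N"
    "t = frag_of (m \<cdot>\<^bsub>M\<^esub> r, n) - frag_of (m, r \<odot>\<^bsub>N\<^esub> n)" by blast
  then show ?case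
    using assms(1) by (intro UnI2)
      (force simp: frag_extend_diff M.lsmult_closed M.smult_rsmult_assoc[symmetric])
qed

text \<open>\<open>act s\<close> is additive, so it suffices that it preserves generators. This
  makes the induced action independent of representatives.\<close>

lemma act_rel:
  assumes "s \<in> carrier S" "t \<in> tensor_rel R M N"
  shows "act s t \<in> tensor_rel R M N"
  using assms(2) unfolding tensor_rel_def
proof (induction rule: generate.induct)
  case one
  show ?case using generate.one[of F] by simp
next
  case (incl h)
  then show ?case using assms(1) by (simp add: act_gens generate.incl)
next
  case (inv h)
  \<comment> \<open>In \<open>F\<close>, \<open>inv\<close> is negation for elements of the carrier,
    hence the two memberships.\<close>
  then have "h \<in> carrier F" "act s h \<in> carrier F"
    using tensor_gens_subset act_closed assms(1) by blast+
  then show ?case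
    using generate.inv[OF act_gens[OF assms(1) inv], of F] by (simp add: frag_extend_minus)
next
  case (eng h1 h2)
  then show ?case using generate.eng[OF eng.IH] by (simp add: frag_extend_add)
qed

text \<open>Two representatives differ by a relation, which \<open>act s\<close> maps to a relation,
  so the union in the definition of \<open>tensor\<close> runs over a constant family.\<close>

lemma smult_coset:
  assumes "s \<in> carrier S" "t \<in> carrier F"
  shows "s \<odot>\<^bsub>T\<^esub> coset t = coset (act s t)"
proof -
  have const: "coset (act s t') = coset (act s t)" if "t' \<in> coset t" for t'
  proof -
    have *: "t' - t \<in> tensor_rel R M N" using that by (simp only: mem_coset_iff)
    have "(t' - t) \<otimes>\<^bsub>F\<^esub> t \<in> carrier F"
      by (rule F.m_closed[OF rel.mem_carrier[OF *] assms(2)])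
    then have "t' \<in> carrier F" by (simp only: mult_free_Abelian_group diff_add_cancel)
    moreover have "act s t' - act s t \<in> tensor_rel R M N"
      using act_rel[OF assms(1) *] by (simp only: frag_extend_diff)
    ultimately show ?thesis
      using act_closed assms by (simp only: coset_eq_iff)
  qed
  \<comment> \<open>The coset is nonempty, so the union of the constant family is that constant and
    not the empty set.\<close>
  have "t \<in> coset t"
    using rel.one_closed by (simp add: mem_coset_iff)
  then have "(\<Union>t' \<in> coset t. coset (act s t')) = coset (act s t)"
    by (rule UN_constant_eq) (intro ballI const)
  then show ?thesis
    by (simp only: tensor_def Let_def module.simps)
qed

lemma smult_tensor_elt:
  "\<lbrakk>s \<in> carrier S; m \<in> carrier M; n \<in> carrier N\<rbrakk> \<Longrightarrow> s \<odot>\<^bsub>T\<^esub> (m \<otimes>\<^sub>T n) = (s \<odot>\<^bsub>M\<^esub> m) \<otimes>\<^sub>T n"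
  unfolding tensor_elt_def by (subst smult_coset) auto

lemma smult_tensor_closed: "\<lbrakk>s \<in> carrier S; \<omega> \<in> carrier T\<rbrakk> \<Longrightarrow> s \<odot>\<^bsub>T\<^esub> \<omega> \<in> carrier T"
  by (auto simp: carrier_tensor smult_coset act_closed simp del: carrier_free_Abelian_group_iff)

lemma smult_tensor_add:
  assumes "s \<in> carrier S" "\<omega> \<in> carrier T" "\<omega>' \<in> carrier T"
  shows "s \<odot>\<^bsub>T\<^esub> (\<omega> \<oplus>\<^bsub>T\<^esub> \<omega>') = s \<odot>\<^bsub>T\<^esub> \<omega> \<oplus>\<^bsub>T\<^esub> s \<odot>\<^bsub>T\<^esub> \<omega>'"
proof -
  obtain t t' where "t \<in> carrier F" "\<omega> = coset t" "t' \<in> carrier F" "\<omega>' = coset t'"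
    using assms by (auto simp: carrier_tensor)
  moreover from this have "t + t' \<in> carrier F" using F.m_closed[of t t'] by simp
  ultimately show ?thesis
    using assms(1) by (simp add: coset_add smult_coset act_closed frag_extend_add
        del: carrier_free_Abelian_group_iff)
qed

text \<open>For associativity, the unit law and distributivity over sums of scalars, both sides are
  additive in \<omega>. It is therefore enough to compare them on pure tensors, where they are laws
  of \<open>M\<close>.\<close>

sublocale LT: left_module S T
proof
  fix a b \<omega> assume ab: "a \<in> carrier S" "b \<in> carrier S" and \<omega>: "\<omega> \<in> carrier T"
  note simps = smult_tensor_closed smult_tensor_add smult_tensor_elt M.lsmult_closed ab
  show "(a \<oplus> b) \<odot>\<^bsub>T\<^esub> \<omega> = a \<odot>\<^bsub>T\<^esub> \<omega> \<oplus>\<^bsub>T\<^esub> b \<odot>\<^bsub>T\<^esub> \<omega>"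
    by (rule additive_eqI[OF \<omega> T.abelian_group_axioms])
      (auto simp: simps T.a_ac M.lsmult_l_distr tensor_elt_add_left)
  show "(a \<otimes> b) \<odot>\<^bsub>T\<^esub> \<omega> = a \<odot>\<^bsub>T\<^esub> (b \<odot>\<^bsub>T\<^esub> \<omega>)"
    by (rule additive_eqI[OF \<omega> T.abelian_group_axioms])
      (auto simp: simps M.lsmult_assoc)
next
  fix \<omega> assume \<omega>: "\<omega> \<in> carrier T"
  show "\<one> \<odot>\<^bsub>T\<^esub> \<omega> = \<omega>"
    by (rule additive_eqI[OF \<omega> T.abelian_group_axioms])
      (auto simp: smult_tensor_closed smult_tensor_add smult_tensor_elt M.lsmult_one)
qed (simp_all add: smult_tensor_closed smult_tensor_add)

end

text \<open>Commutativity of \<open>K\<close> is what turns a left action into a right one: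
  \<open>x (a b) = (x a) b\<close> reads \<open>(a b) x = b (a x)\<close>.\<close>

lemma bimodule_symmetric_bimod:
  assumes "module K A"
  shows "bimodule K K (symmetric_bimod A)"
proof -
  interpret module K A by fact
  interpret S: abelian_group "symmetric_bimod A"
    using M.add.l_inv_ex by (intro abelian_groupI) (auto simp: symmetric_bimod_def M.a_ac)
  show ?thesis
    by unfold_locales
      (auto simp: symmetric_bimod_def smult_l_distr smult_r_distr smult_assoc1 R.m_comm
        simp flip: smult_assoc1)
qed

lemma left_module_of_module:
  assumes "module K A"
  shows "left_module K A"
proof -
  interpret module K A by fact
  show ?thesis
    by unfold_locales (auto simp: smult_l_distr smult_r_distr smult_assoc1)
qed

section \<open>The extension algebra and the jet bundle\<close>

text \<open>\<open>C\<close> is a Hochschild 2-cocycle of \<open>A\<close> with values in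
  \<open>I\<close>, and \<open>B\<close> is the extension of \<open>A\<close> by the square-zero
  ideal \<open>I\<close> that it defines.\<close>

locale hochschild_extension = A: ring A + G: abelian_group I + I: left_right_module k A I
  for k (structure) and A (structure) and I (structure) +
  fixes C
  assumes C: "C \<in> cochains k A I" and cocycle: "cocycle_condition k A I C"
begin

abbreviation "c \<equiv> cochain_app k A C"
abbreviation "B \<equiv> ext_algebra k A I C"

sublocale AA: balanced_pair k k "symmetric_bimod A" A
  by (intro balanced_pair.intro bimodule_symmetric_bimod left_module_of_module I.module_axioms)

section \<open>The cocycle as a biadditive map of two variables\<close>

lemma c_closed [simp, intro]: "\<lbrakk>x \<in> carrier A; y \<in> carrier A\<rbrakk> \<Longrightarrow> c x y \<in> carrier I"
  using C AA.tensor_elt_closed[of x y]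
  by (auto simp: cochain_app_def cochains_def linear_maps_def restrict_scalars_def symmetric_bimod_def)

lemma c_add_left:
  assumes "x \<in> carrier A" "x' \<in> carrier A" "y \<in> carrier A"
  shows "c (x \<oplus>\<^bsub>A\<^esub> x') y = c x y \<oplus>\<^bsub>I\<^esub> c x' y"
  using C assms AA.tensor_elt_add_left[of x x' y] AA.tensor_elt_closed[of _ y]
  by (auto simp: cochain_app_def cochains_def linear_maps_def restrict_scalars_def symmetric_bimod_def)

lemma c_add_right:
  assumes "x \<in> carrier A" "y \<in> carrier A" "y' \<in> carrier A"
  shows "c x (y \<oplus>\<^bsub>A\<^esub> y') = c x y \<oplus>\<^bsub>I\<^esub> c x y'"
  using C assms AA.tensor_elt_add_right[of x y y'] AA.tensor_elt_closed[of x]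
  by (auto simp: cochain_app_def cochains_def linear_maps_def restrict_scalars_def symmetric_bimod_def)

text \<open>Moving the negative terms across gives exactly the identity that compares the two triple
  products in \<open>B\<close>.\<close>

lemma c_cocycle:
  assumes "x \<in> carrier A" "y \<in> carrier A" "z \<in> carrier A"
  shows "c x y \<cdot>\<^bsub>I\<^esub> z \<oplus>\<^bsub>I\<^esub> c (x \<otimes>\<^bsub>A\<^esub> y) z = x \<odot>\<^bsub>I\<^esub> c y z \<oplus>\<^bsub>I\<^esub> c x (y \<otimes>\<^bsub>A\<^esub> z)"
proof -
  have closed: "x \<odot>\<^bsub>I\<^esub> c y z \<in> carrier I" "c (x \<otimes>\<^bsub>A\<^esub> y) z \<in> carrier I"
    "c x (y \<otimes>\<^bsub>A\<^esub> z) \<in> carrier I" "c x y \<cdot>\<^bsub>I\<^esub> z \<in> carrier I"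
    using assms by (auto simp: I.lsmult_closed I.rsmult_closed)
  have "x \<odot>\<^bsub>I\<^esub> c y z \<ominus>\<^bsub>I\<^esub> c (x \<otimes>\<^bsub>A\<^esub> y) z \<oplus>\<^bsub>I\<^esub> c x (y \<otimes>\<^bsub>A\<^esub> z) = c x y \<cdot>\<^bsub>I\<^esub> z"
    using cocycle assms closed unfolding cocycle_condition_def
    by (metis G.minus_closed G.a_closed G.a_inv_closed G.minus_eq G.minus_equality G.minus_minus)
  then have "c x y \<cdot>\<^bsub>I\<^esub> z \<oplus>\<^bsub>I\<^esub> c (x \<otimes>\<^bsub>A\<^esub> y) z =
      x \<odot>\<^bsub>I\<^esub> c y z \<ominus>\<^bsub>I\<^esub> c (x \<otimes>\<^bsub>A\<^esub> y) z \<oplus>\<^bsub>I\<^esub> c x (y \<otimes>\<^bsub>A\<^esub> z) \<oplus>\<^bsub>I\<^esub> c (x \<otimes>\<^bsub>A\<^esub> y) z"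
    by simp
  \<comment> \<open>Commuting the summands brings the term next to its negative.\<close>
  also have "\<dots> = x \<odot>\<^bsub>I\<^esub> c y z \<oplus>\<^bsub>I\<^esub> c x (y \<otimes>\<^bsub>A\<^esub> z) \<oplus>\<^bsub>I\<^esub> (\<ominus>\<^bsub>I\<^esub> c (x \<otimes>\<^bsub>A\<^esub> y) z \<oplus>\<^bsub>I\<^esub> c (x \<otimes>\<^bsub>A\<^esub> y) z)"
    using closed by (simp add: G.minus_eq G.a_ac)
  also have "\<dots> = x \<odot>\<^bsub>I\<^esub> c y z \<oplus>\<^bsub>I\<^esub> c x (y \<otimes>\<^bsub>A\<^esub> z)"
    using closed by (simp add: G.l_neg)
  finally show ?thesis .
qed

text \<open>In the cocycle identity at \<open>(1, 1, x)\<close> one copy of \<open>c 1 x\<close>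
  cancels; the instance at \<open>(x, 1, 1)\<close> gives the mirror image. These values make
  \<open>- c 1 1\<close> the right correction in the unit of \<open>B\<close>.\<close>

lemma c_one_left: "x \<in> carrier A \<Longrightarrow> c \<one>\<^bsub>A\<^esub> x = c \<one>\<^bsub>A\<^esub> \<one>\<^bsub>A\<^esub> \<cdot>\<^bsub>I\<^esub> x"
  using c_cocycle[of "\<one>\<^bsub>A\<^esub>" "\<one>\<^bsub>A\<^esub>" x] by (simp add: I.lsmult_one I.rsmult_closed)

lemma c_one_right: "x \<in> carrier A \<Longrightarrow> c x \<one>\<^bsub>A\<^esub> = x \<odot>\<^bsub>I\<^esub> c \<one>\<^bsub>A\<^esub> \<one>\<^bsub>A\<^esub>"
  using c_cocycle[of x "\<one>\<^bsub>A\<^esub>" "\<one>\<^bsub>A\<^esub>"] by (simp add: I.rsmult_one I.lsmult_closed)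

lemma smult_minus: "\<lbrakk>x \<in> carrier A; u \<in> carrier I\<rbrakk> \<Longrightarrow> x \<odot>\<^bsub>I\<^esub> (\<ominus>\<^bsub>I\<^esub> u) = \<ominus>\<^bsub>I\<^esub> (x \<odot>\<^bsub>I\<^esub> u)"
  by (rule G.additive_minus[OF G.abelian_group_axioms])
    (auto simp: I.lsmult_closed I.lsmult_r_distr)

lemma rsmult_minus: "\<lbrakk>x \<in> carrier A; u \<in> carrier I\<rbrakk> \<Longrightarrow> (\<ominus>\<^bsub>I\<^esub> u) \<cdot>\<^bsub>I\<^esub> x = \<ominus>\<^bsub>I\<^esub> (u \<cdot>\<^bsub>I\<^esub> x)"
  by (rule G.additive_minus[OF G.abelian_group_axioms, where h = "\<lambda>u. u \<cdot>\<^bsub>I\<^esub> x"])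
    (auto simp: I.rsmult_closed I.rsmult_l_distr)

text \<open>Associativity is the cocycle identity, the unit laws use the values of \<open>c\<close>
  at one, and distributivity comes from biadditivity of \<open>c\<close>.\<close>

lemma ring_ext_algebra: "ring B"
proof (rule ringI)
  note closed = I.lsmult_closed I.rsmult_closed
  show "abelian_group B"
    by (rule abelian_groupI)
      (auto simp: ext_algebra_def G.a_ac A.a_ac G.r_neg A.r_neg
        intro!: bexI[of _ "\<ominus>\<^bsub>I\<^esub> _"] bexI[of _ "\<ominus>\<^bsub>A\<^esub> _"])
  show "monoid B"
  proof (rule monoidI)
    fix p q r assume "p \<in> carrier B" "q \<in> carrier B" "r \<in> carrier B"
    then obtain u x v y w z where eqs: "p = (u, x)" "q = (v, y)" "r = (w, z)"
      and mem: "u \<in> carrier I" "v \<in> carrier I" "w \<in> carrier I"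
        "x \<in> carrier A" "y \<in> carrier A" "z \<in> carrier A"
      by (auto simp: ext_algebra_def)
    \<comment> \<open>After expansion both triple products contain the first three summands; what
      remains are the two sides of \<open>c_cocycle\<close>.\<close>
    have "u \<cdot>\<^bsub>I\<^esub> (y \<otimes>\<^bsub>A\<^esub> z) \<oplus>\<^bsub>I\<^esub> x \<odot>\<^bsub>I\<^esub> (v \<cdot>\<^bsub>I\<^esub> z) \<oplus>\<^bsub>I\<^esub> (x \<otimes>\<^bsub>A\<^esub> y) \<odot>\<^bsub>I\<^esub> w \<oplus>\<^bsub>I\<^esub>
        (c x y \<cdot>\<^bsub>I\<^esub> z \<oplus>\<^bsub>I\<^esub> c (x \<otimes>\<^bsub>A\<^esub> y) z) =
      u \<cdot>\<^bsub>I\<^esub> (y \<otimes>\<^bsub>A\<^esub> z) \<oplus>\<^bsub>I\<^esub> x \<odot>\<^bsub>I\<^esub> (v \<cdot>\<^bsub>I\<^esub> z) \<oplus>\<^bsub>I\<^esub> (x \<otimes>\<^bsub>A\<^esub> y) \<odot>\<^bsub>I\<^esub> w \<oplus>\<^bsub>I\<^esub>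
        (x \<odot>\<^bsub>I\<^esub> c y z \<oplus>\<^bsub>I\<^esub> c x (y \<otimes>\<^bsub>A\<^esub> z))"
      using c_cocycle mem by simp
    then show "(p \<otimes>\<^bsub>B\<^esub> q) \<otimes>\<^bsub>B\<^esub> r = p \<otimes>\<^bsub>B\<^esub> (q \<otimes>\<^bsub>B\<^esub> r)"
      using mem unfolding eqs
      by (simp add: ext_algebra_def closed A.m_assoc I.rsmult_l_distr I.lsmult_r_distr
          I.smult_rsmult_assoc I.rsmult_assoc I.lsmult_assoc G.a_ac)
  next
    fix p assume "p \<in> carrier B"
    then obtain u x where "p = (u, x)" "u \<in> carrier I" "x \<in> carrier A"
      by (auto simp: ext_algebra_def)
    \<comment> \<open>The correction multiplied by \<open>x\<close> cancels \<open>c 1 x\<close>,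
      respectively \<open>c x 1\<close>, and leaves \<open>u\<close>.\<close>
    then show "\<one>\<^bsub>B\<^esub> \<otimes>\<^bsub>B\<^esub> p = p" "p \<otimes>\<^bsub>B\<^esub> \<one>\<^bsub>B\<^esub> = p"
      using c_one_left[of x] c_one_right[of x]
      by (simp_all add: ext_algebra_def closed smult_minus rsmult_minus I.lsmult_one I.rsmult_one
          G.a_ac G.l_neg G.r_neg G.r_neg1 G.r_neg2)
  qed (auto simp: ext_algebra_def closed)
qed (auto simp: ext_algebra_def I.lsmult_closed I.rsmult_closed A.l_distr A.r_distr I.rsmult_l_distr I.rsmult_r_distr
    I.lsmult_l_distr I.lsmult_r_distr c_add_left c_add_right G.a_ac)

end

section \<open>The derivation and the action on the jet bundle\<close>

locale jet_action = hochschild_extension k A I C + H: abelian_group E + E: left_right_module k A E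
  for k (structure) and A (structure) and I (structure) and C and E (structure) +
  fixes d
  assumes d: "d \<in> Der k A I"
begin

abbreviation "J \<equiv> jet_bundle A I E d"

text \<open>Balancing identifies the right action on \<open>I\<close> with the left action on
  \<open>E\<close>; the left action on \<open>I\<close> induces the one on
  \<open>I \<otimes> E\<close>.\<close>

sublocale IE: balanced_pair A A I E
  by (intro balanced_pair.intro I.bimodule_axioms E.left_module_axioms)

lemma d_closed [simp, intro]: "x \<in> carrier A \<Longrightarrow> d x \<in> carrier I"
  using d by (auto simp: Der_def linear_maps_def restrict_scalars_def)

lemma d_add: "\<lbrakk>x \<in> carrier A; y \<in> carrier A\<rbrakk> \<Longrightarrow> d (x \<oplus>\<^bsub>A\<^esub> y) = d x \<oplus>\<^bsub>I\<^esub> d y"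
  using d by (auto simp: Der_def linear_maps_def restrict_scalars_def)

lemma d_mult:
  "\<lbrakk>x \<in> carrier A; y \<in> carrier A\<rbrakk> \<Longrightarrow> d (x \<otimes>\<^bsub>A\<^esub> y) = x \<odot>\<^bsub>I\<^esub> d y \<oplus>\<^bsub>I\<^esub> d x \<cdot>\<^bsub>I\<^esub> y"
  using d by (auto simp: Der_def)

text \<open>The Leibniz rule at \<open>(1, 1)\<close> reads \<open>d 1 = d 1 + d 1\<close>. This
  removes the derivation term from the action of the unit.\<close>

lemma d_one: "d \<one>\<^bsub>A\<^esub> = \<zero>\<^bsub>I\<^esub>"
  using d_mult[of "\<one>\<^bsub>A\<^esub>" "\<one>\<^bsub>A\<^esub>"]
  by (simp add: I.lsmult_one I.rsmult_one)

lemma zero_tensor: "f \<in> carrier E \<Longrightarrow> tensor_elt A I E \<zero>\<^bsub>I\<^esub> f = \<zero>\<^bsub>tensor A I E\<^esub>"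
  by (rule G.additive_zero[OF IE.T.abelian_group_axioms, where h = "\<lambda>u. tensor_elt A I E u f"])
    (auto simp: IE.tensor_elt_add_left)

lemma minus_tensor:
  "\<lbrakk>u \<in> carrier I; f \<in> carrier E\<rbrakk> \<Longrightarrow>
    tensor_elt A I E (\<ominus>\<^bsub>I\<^esub> u) f = \<ominus>\<^bsub>tensor A I E\<^esub> tensor_elt A I E u f"
  by (rule G.additive_minus[OF IE.T.abelian_group_axioms, where h = "\<lambda>u. tensor_elt A I E u f"])
    (auto simp: IE.tensor_elt_add_left)

lemma carrier_jet: "carrier J = carrier IE.T \<times> carrier E"
  by (simp add: jet_bundle_def Let_def)

lemma zero_jet: "\<zero>\<^bsub>J\<^esub> = (\<zero>\<^bsub>IE.T\<^esub>, \<zero>\<^bsub>E\<^esub>)"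
  by (simp add: jet_bundle_def Let_def)

lemma add_jet: "(\<omega>, f) \<oplus>\<^bsub>J\<^esub> (\<omega>', f') = (\<omega> \<oplus>\<^bsub>IE.T\<^esub> \<omega>', f \<oplus>\<^bsub>E\<^esub> f')"
  by (simp add: jet_bundle_def Let_def)

lemma smult_jet:
  "(u, x) \<odot>\<^bsub>J\<^esub> (\<omega>, f) =
    (tensor_elt A I E u f \<oplus>\<^bsub>IE.T\<^esub> x \<odot>\<^bsub>IE.T\<^esub> \<omega> \<oplus>\<^bsub>IE.T\<^esub> tensor_elt A I E (d x) f, x \<odot>\<^bsub>E\<^esub> f)"
  by (simp add: jet_bundle_def Let_def)

lemmas jet_simps = carrier_jet zero_jet add_jet smult_jet

lemma abelian_group_jet: "abelian_group J"
  by (rule abelian_groupI)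
    (auto simp: jet_simps IE.T.a_ac H.a_ac IE.T.r_neg H.r_neg
      intro!: bexI[of _ "\<ominus>\<^bsub>IE.T\<^esub> _"] bexI[of _ "\<ominus>\<^bsub>E\<^esub> _"])

text \<open>With \<open>p = (u, x)\<close> and \<open>q = (v, y)\<close>, balancing turns
  \<open>u y \<otimes> f\<close> into \<open>u \<otimes> y f\<close>, and the Leibniz rule splits
  \<open>d (x y) \<otimes> f\<close> into \<open>x (d y \<otimes> f)\<close> and
  \<open>d x \<otimes> y f\<close>. These are terms of the iterated action, so only the summand with
  \<open>c\<close> is left over. The \<open>E\<close> components agree, hence the zero.\<close>

lemma smult_jet_mult:
  assumes "p \<in> carrier B" "q \<in> carrier B" "(\<omega>, f) \<in> carrier J"
  shows "(p \<otimes>\<^bsub>B\<^esub> q) \<odot>\<^bsub>J\<^esub> (\<omega>, f) =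
    p \<odot>\<^bsub>J\<^esub> (q \<odot>\<^bsub>J\<^esub> (\<omega>, f)) \<oplus>\<^bsub>J\<^esub> (tensor_elt A I E (c (snd p) (snd q)) f, \<zero>\<^bsub>E\<^esub>)"
proof -
  obtain u x v y where "p = (u, x)" "q = (v, y)" "u \<in> carrier I" "v \<in> carrier I"
    "x \<in> carrier A" "y \<in> carrier A"
    using assms by (auto simp: ext_algebra_def)
  then show ?thesis
    using assms(3)
    by (simp add: ext_algebra_def jet_simps d_mult IE.tensor_elt_add_left IE.tensor_elt_balanced
        IE.smult_tensor_add IE.smult_tensor_elt IE.smult_tensor_closed I.lsmult_closed
        I.rsmult_closed E.lsmult_closed E.lsmult_assoc IE.LT.lsmult_assoc IE.T.a_ac)
qed

text \<open>The subtracted tensor is the associativity defect at \<open>y = x = 1\<close>, so the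
  unit law imposes no condition beyond associativity.\<close>

lemma smult_jet_one:
  "(\<omega>, f) \<in> carrier J \<Longrightarrow>
    \<one>\<^bsub>B\<^esub> \<odot>\<^bsub>J\<^esub> (\<omega>, f) = (\<omega> \<ominus>\<^bsub>IE.T\<^esub> tensor_elt A I E (c \<one>\<^bsub>A\<^esub> \<one>\<^bsub>A\<^esub>) f, f)"
  by (simp add: ext_algebra_def jet_simps d_one zero_tensor minus_tensor IE.LT.lsmult_one
      E.lsmult_one IE.T.a_ac IE.T.minus_eq)

text \<open>The defect enters \<open>smult_jet_mult\<close> as a summand: cancelling in the group
  \<open>J\<close> gives one direction, inserting zero for it the other.\<close>

theorem left_module_jet_iff:
  "left_module B J \<longleftrightarrow>
    (\<forall>y \<in> carrier A. \<forall>x \<in> carrier A. \<forall>f \<in> carrier E. tensor_elt A I E (c y x) f = \<zero>\<^bsub>IE.T\<^esub>)"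
    (is "_ \<longleftrightarrow> ?flat")
proof
  assume mod: "left_module B J"
  interpret GJ: abelian_group J by (rule abelian_group_jet)
  interpret J: left_module B J by (rule mod)
  show ?flat
  proof (intro ballI)
    fix y x f assume mem: "y \<in> carrier A" "x \<in> carrier A" "f \<in> carrier E"
    \<comment> \<open>The defect depends only on the \<open>A\<close> components and on
      \<open>f\<close>, so the other components can be taken to be zero.\<close>
    define p q m where "p = (\<zero>\<^bsub>I\<^esub>, y)" and "q = (\<zero>\<^bsub>I\<^esub>, x)" and "m = (\<zero>\<^bsub>IE.T\<^esub>, f)"
    have pq: "p \<in> carrier B" "q \<in> carrier B" and m: "m \<in> carrier J"
      using mem by (auto simp: p_def q_def m_def ext_algebra_def carrier_jet)
    have "p \<odot>\<^bsub>J\<^esub> (q \<odot>\<^bsub>J\<^esub> m) \<oplus>\<^bsub>J\<^esub> (tensor_elt A I E (c y x) f, \<zero>\<^bsub>E\<^esub>) = p \<odot>\<^bsub>J\<^esub> (q \<odot>\<^bsub>J\<^esub> m)"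
      using smult_jet_mult[OF pq, of "\<zero>\<^bsub>IE.T\<^esub>" f] J.lsmult_assoc[OF pq m] m
      by (simp add: p_def q_def m_def)
    moreover have "p \<odot>\<^bsub>J\<^esub> (q \<odot>\<^bsub>J\<^esub> m) \<in> carrier J"
      using pq m by (intro J.lsmult_closed)
    moreover have "(tensor_elt A I E (c y x) f, \<zero>\<^bsub>E\<^esub>) \<in> carrier J"
      using mem by (simp add: carrier_jet IE.tensor_elt_closed)
    ultimately have "(tensor_elt A I E (c y x) f, \<zero>\<^bsub>E\<^esub>) = \<zero>\<^bsub>J\<^esub>"
      by (simp only: GJ.add.l_cancel_one)
    then show "tensor_elt A I E (c y x) f = \<zero>\<^bsub>IE.T\<^esub>" by (simp add: zero_jet)
  qed
next
  assume flat: ?flat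
  interpret B: ring B by (rule ring_ext_algebra)
  interpret J: abelian_group J by (rule abelian_group_jet)
  note closed = IE.smult_tensor_closed I.lsmult_closed I.rsmult_closed E.lsmult_closed
  show "left_module B J"
  proof
    fix p m assume "p \<in> carrier B" "m \<in> carrier J"
    then show "p \<odot>\<^bsub>J\<^esub> m \<in> carrier J"
      by (auto simp: ext_algebra_def jet_simps closed)
  next
    fix p q m assume "p \<in> carrier B" "q \<in> carrier B" "m \<in> carrier J"
    \<comment> \<open>Additivity of \<open>d\<close> enters here.\<close>
    then show "(p \<oplus>\<^bsub>B\<^esub> q) \<odot>\<^bsub>J\<^esub> m = p \<odot>\<^bsub>J\<^esub> m \<oplus>\<^bsub>J\<^esub> q \<odot>\<^bsub>J\<^esub> m"
      by (auto simp: ext_algebra_def jet_simps closed d_add IE.tensor_elt_add_left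
          IE.LT.lsmult_l_distr E.lsmult_l_distr IE.T.a_ac)
  next
    fix p m m' assume "p \<in> carrier B" "m \<in> carrier J" "m' \<in> carrier J"
    then show "p \<odot>\<^bsub>J\<^esub> (m \<oplus>\<^bsub>J\<^esub> m') = p \<odot>\<^bsub>J\<^esub> m \<oplus>\<^bsub>J\<^esub> p \<odot>\<^bsub>J\<^esub> m'"
      by (auto simp: ext_algebra_def jet_simps closed IE.tensor_elt_add_right
          IE.smult_tensor_add E.lsmult_r_distr IE.T.a_ac)
  next
    fix p q m assume pq: "p \<in> carrier B" "q \<in> carrier B" and m: "m \<in> carrier J"
    then have "snd p \<in> carrier A" "snd q \<in> carrier A" "p \<odot>\<^bsub>J\<^esub> (q \<odot>\<^bsub>J\<^esub> m) \<in> carrier J"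
      by (auto simp: ext_algebra_def jet_simps closed)
    \<comment> \<open>By hypothesis the defect pair is \<open>(0, 0)\<close>; it is folded back into
      the zero of \<open>J\<close> so that the group law removes it.\<close>
    then show "(p \<otimes>\<^bsub>B\<^esub> q) \<odot>\<^bsub>J\<^esub> m = p \<odot>\<^bsub>J\<^esub> (q \<odot>\<^bsub>J\<^esub> m)"
      using smult_jet_mult[OF pq, of "fst m" "snd m"] flat m
      by (auto simp: carrier_jet simp flip: zero_jet)
  next
    have minus_zero: "\<ominus>\<^bsub>IE.T\<^esub> \<zero>\<^bsub>IE.T\<^esub> = \<zero>\<^bsub>IE.T\<^esub>"
      by (rule IE.T.minus_equality) simp_all
    fix m assume "m \<in> carrier J"
    \<comment> \<open>The hypothesis at \<open>y = x = 1\<close> makes the subtracted tensor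
      zero.\<close>
    then show "\<one>\<^bsub>B\<^esub> \<odot>\<^bsub>J\<^esub> m = m"
      using smult_jet_one[of "fst m" "snd m"] flat
      by (auto simp: carrier_jet IE.T.minus_eq minus_zero)
  qed
qed

end

theorem proposition2p21:
  fixes k :: "'k ring"
    and A :: "('k, 'a) module"
    and I :: "('a, 'a, 'i) bimod"
    and E :: "('a, 'a, 'e) bimod"
    and C :: "('a \<times> 'a \<Rightarrow>\<^sub>0 int) set \<Rightarrow> 'i"
    and d :: "'a \<Rightarrow> 'i"
  assumes "field k"
    and "assoc_algebra k A"
    and "left_right_module k A I"
    and "left_right_module k A E"
    and "C \<in> cochains k A I"
    and "cocycle_condition k A I C"
    and "d \<in> Der k A I"
  shows "left_module (ext_algebra k A I C) (jet_bundle A I E d) \<longleftrightarrow>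
    (\<forall>y \<in> carrier A. \<forall>x \<in> carrier A. \<forall>f \<in> carrier E.
       tensor_elt A I E (cochain_app k A C y x) f = \<zero>\<^bsub>tensor A I E\<^esub>)"
proof -
  interpret I: left_right_module k A I by fact
  interpret E: left_right_module k A E by fact
  interpret jet_action k A I C E d
    by unfold_locales fact+
  show ?thesis by (rule left_module_jet_iff)
qed

end
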